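(* For every $n\in\omega+1$ there are mass problems $\mathcal{A},\mathcal{B}\subseteq\omega^\omega$ with $\mathcal{A}\leq_n\mathcal{B}$ such that for no $m<n$ we have $\mathcal{A}\leq_m\mathcal{B}$.
   Context: A mass problem is a subset of $\omega^\omega$. $\Phi_e$ is the Turing functional with index $e$; writing $\Phi_e(f)\in\mathcal{A}$ means in particular that $\Phi_e(f)$ is total. $\Pi^0_n$-classes are the effective (lightface) $\Pi^0_n$ subsets of $\omega^\omega$; a sequence of classes is uniformly $\Pi^0_n$ if it has a computable sequence of $\Pi^0_n$-indices. For $n=0$, $\Pi^0_0$-classes are finite Boolean combinations of cylinders $\{f \mid \sigma\subset f\}$, $\sigma\in\omega^{<\omega}$. For $n\in\omega$ and $\mathcal{A},\mathcal{B}\subseteq\omega^\omega$, $\mathcal{A}\leq_n\mathcal{B}$ means: there are a uniformly $\Pi^0_n$ sequence $\mathcal{V}_0,\mathcal{V}_1,\dots$ with $\mathcal{B}\subseteq\bigcup_i\mathcal{V}_i$ and a computable sequence $e_0,e_1,\dots$ such that for every $i$ and every $f\in\mathcal{B}\cap\mathcal{V}_i$ we have $\Phi_{e_i}(f)\in\mathcal{A}$. $\leq_\omega$ denotes Muchnik reducibility: $\mathcal{A}\leq_\omega\mathcal{B}$ iff every $f\in\mathcal{B}$ computes some $g\in\mathcal{A}$. *)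

theory Defs
  imports Complex_Main "HOL-Library.Nat_Bijection" "HOL-Library.Extended_Nat"
begin

subsection \<open>Turing functionals\<close>

datatype prog =
    Zero
  | Succ
  | Proj nat
  | Oracle
  | Comp prog "prog list"
  | PRec prog prog
  | Mu prog

text \<open>
  \<open>eval f p xs y\<close>: with oracle \<open>f\<close>, the program \<open>p\<close> halts on the arguments \<open>xs\<close> with output \<open>y\<close>.
  These are Kleene's schemes for the partial functions recursive in \<open>f\<close>. Minimisation is the
  unbounded search that diverges when an earlier value diverges.
\<close>

inductive eval :: "(nat \<Rightarrow> nat) \<Rightarrow> prog \<Rightarrow> nat list \<Rightarrow> nat \<Rightarrow> bool" for f :: "nat \<Rightarrow> nat" where
  eval_Zero: "eval f Zero xs 0"
| eval_Succ: "eval f Succ [x] (Suc x)"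
| eval_Proj: "i < length xs \<Longrightarrow> eval f (Proj i) xs (xs ! i)"
| eval_Oracle: "eval f Oracle [x] (f x)"
| eval_Comp: "list_all2 (\<lambda>q z. eval f q xs z) qs zs \<Longrightarrow> eval f p zs y \<Longrightarrow> eval f (Comp p qs) xs y"
| eval_PRec_0: "eval f p xs y \<Longrightarrow> eval f (PRec p q) (0 # xs) y"
| eval_PRec_Suc: "eval f (PRec p q) (n # xs) z \<Longrightarrow> eval f q (n # z # xs) y
    \<Longrightarrow> eval f (PRec p q) (Suc n # xs) y"
| eval_Mu: "eval f p (n # xs) 0 \<Longrightarrow> (\<forall>m<n. \<exists>k. eval f p (m # xs) (Suc k))
    \<Longrightarrow> eval f (Mu p) xs n"
monos list_all2_mono

primrec prog_code :: "prog \<Rightarrow> nat" where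
  "prog_code Zero = prod_encode (0, 0)"
| "prog_code Succ = prod_encode (1, 0)"
| "prog_code (Proj i) = prod_encode (2, i)"
| "prog_code Oracle = prod_encode (3, 0)"
| "prog_code (Comp p qs) =
     prod_encode (4, prod_encode (prog_code p, list_encode (map prog_code qs)))"
| "prog_code (PRec p q) = prod_encode (5, prod_encode (prog_code p, prog_code q))"
| "prog_code (Mu p) = prod_encode (6, prog_code p)"

text \<open>
  \<open>Phi e f x y\<close> says that \<open>\<Phi>\<^sub>e(f)(x)\<close> is defined with value \<open>y\<close>. A number that is not the
  code of a program (a decidable condition) is an index of the nowhere defined functional.
\<close>

definition Phi :: "nat \<Rightarrow> (nat \<Rightarrow> nat) \<Rightarrow> nat \<Rightarrow> nat \<Rightarrow> bool" where
  "Phi e f x y \<longleftrightarrow> (\<exists>p. e = prog_code p \<and> eval f p [x] y)"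

text \<open>\<open>Phi_total e f g\<close> says that \<open>\<Phi>\<^sub>e(f)\<close> is total and equal to \<open>g\<close>.\<close>

definition Phi_total :: "nat \<Rightarrow> (nat \<Rightarrow> nat) \<Rightarrow> (nat \<Rightarrow> nat) \<Rightarrow> bool" where
  "Phi_total e f g \<longleftrightarrow> (\<forall>x. Phi e f x (g x))"

text \<open>Oracle-free computation is computation with the constant oracle \<open>0\<close>.\<close>

definition phi :: "nat \<Rightarrow> nat \<Rightarrow> nat \<Rightarrow> bool" where
  "phi e x y \<longleftrightarrow> Phi e (\<lambda>_. 0) x y"

definition computable :: "(nat \<Rightarrow> nat) \<Rightarrow> bool" where
  "computable h \<longleftrightarrow> (\<exists>e. \<forall>x. phi e x (h x))"

lemma inj_prog_code: "prog_code p = prog_code q \<Longrightarrow> p = q"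
proof (induction p arbitrary: q)
  case (Comp p ps)
  then obtain q' qs where q: "q = Comp q' qs" by (cases q) auto
  have "map prog_code ps = map prog_code qs" using Comp.prems q by (simp add: list_encode_eq)
  then have "ps = qs"
    using Comp.IH(2) by (metis list.inj_map_strong)
  with Comp q show ?case by simp
next
  case Zero then show ?case by (cases q) auto
next
  case Succ then show ?case by (cases q) auto
next
  case (Proj i) then show ?case by (cases q) auto
next
  case Oracle then show ?case by (cases q) auto
next
  case (PRec p1 p2) then show ?case by (cases q) auto
next
  case (Mu p) then show ?case by (cases q) auto
qed

lemma eval_deterministic: "eval f p xs y \<Longrightarrow> eval f p xs z \<Longrightarrow> y = z"
proof (induction arbitrary: z rule: eval.induct)
  case (eval_Comp xs qs zs p y)
  from eval_Comp.prems obtain zs' where zs': "list_all2 (\<lambda>q z. eval f q xs z) qs zs'"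
    "eval f p zs' z" by cases auto
  have "zs = zs'"
    using eval_Comp.IH(1) zs'(1) by (auto simp: list_all2_conv_all_nth intro!: nth_equalityI)
  with eval_Comp.IH(2) zs'(2) show ?case by simp
next
  case (eval_Mu p n xs)
  from eval_Mu.prems have z: "eval f p (z # xs) 0" "\<forall>m<z. \<exists>k. eval f p (m # xs) (Suc k)"
    by (cases; blast)+
  show ?case
  proof (rule linorder_cases[of n z])
    assume "n < z" with z(2) eval_Mu.IH(1) show ?thesis by blast
  next
    assume "z < n" with z(1) eval_Mu.IH(2) show ?thesis by blast
  qed
next
  case (eval_PRec_Suc p q n xs z y)
  from eval_PRec_Suc.prems show ?case
    by cases (use eval_PRec_Suc.IH in blast)
qed (erule eval.cases; simp)+

lemma Phi_deterministic: "Phi e f x y \<Longrightarrow> Phi e f x z \<Longrightarrow> y = z"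
  unfolding Phi_def using inj_prog_code eval_deterministic by blast

subsection \<open>Effective classes\<close>

definition cylinder :: "nat list \<Rightarrow> (nat \<Rightarrow> nat) set" where
  "cylinder \<sigma> = {f. \<forall>i<length \<sigma>. f i = \<sigma> ! i}"

datatype bcomb =
    Cyl "nat list"
  | Neg bcomb
  | Conj bcomb bcomb

primrec bcomb_set :: "bcomb \<Rightarrow> (nat \<Rightarrow> nat) set" where
  "bcomb_set (Cyl \<sigma>) = cylinder \<sigma>"
| "bcomb_set (Neg b) = - bcomb_set b"
| "bcomb_set (Conj b c) = bcomb_set b \<inter> bcomb_set c"

primrec bcomb_code :: "bcomb \<Rightarrow> nat" where
  "bcomb_code (Cyl \<sigma>) = prod_encode (0, list_encode \<sigma>)"
| "bcomb_code (Neg b) = prod_encode (1, bcomb_code b)"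
| "bcomb_code (Conj b c) = prod_encode (2, prod_encode (bcomb_code b, bcomb_code c))"

lemma inj_bcomb_code: "bcomb_code b = bcomb_code c \<Longrightarrow> b = c"
proof (induction b arbitrary: c)
  case (Cyl \<sigma>) then show ?case by (cases c) (auto simp: list_encode_eq)
next
  case (Neg b) then show ?case by (cases c) auto
next
  case (Conj b1 b2) then show ?case by (cases c) auto
qed

text \<open>
  \<open>Pi_index n e V\<close>: the number \<open>e\<close> is a \<open>\<Pi>\<^sup>0\<^sub>n\<close>-index of the class \<open>V\<close>. For \<open>n = 0\<close> it codes a
  finite Boolean combination of cylinders. A \<open>\<Pi>\<^sup>0\<^sub>n\<^sub>+\<^sub>1\<close>-class is the intersection of a uniformly
  \<open>\<Sigma>\<^sup>0\<^sub>n\<close> sequence, i.e. of the complements of \<open>\<Pi>\<^sup>0\<^sub>n\<close>-classes \<open>W 0, W 1, \<dots>\<close>; an index of it is an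
  index of a total computable function giving \<open>\<Pi>\<^sup>0\<^sub>n\<close>-indices of the \<open>W j\<close>.
  Unfolding gives \<open>V = {f. \<forall>j\<^sub>1. \<exists>j\<^sub>2. \<dots> R(f, j\<^sub>1, \<dots>, j\<^sub>n)}\<close> with a matrix that is clopen, computably
  in \<open>j\<^sub>1, \<dots>, j\<^sub>n\<close>.
\<close>

primrec Pi_index :: "nat \<Rightarrow> nat \<Rightarrow> (nat \<Rightarrow> nat) set \<Rightarrow> bool" where
  "Pi_index 0 e V \<longleftrightarrow> (\<exists>b. e = bcomb_code b \<and> V = bcomb_set b)"
| "Pi_index (Suc n) e V \<longleftrightarrow>
     (\<exists>W. (\<forall>j. \<exists>k. phi e j k \<and> Pi_index n k (W j)) \<and> V = (\<Inter>j. - W j))"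

definition uniformly_Pi :: "nat \<Rightarrow> (nat \<Rightarrow> (nat \<Rightarrow> nat) set) \<Rightarrow> bool" where
  "uniformly_Pi n V \<longleftrightarrow> (\<exists>h. computable h \<and> (\<forall>i. Pi_index n (h i) (V i)))"

subsection \<open>Reducibilities between mass problems\<close>

definition le_fin :: "nat \<Rightarrow> (nat \<Rightarrow> nat) set \<Rightarrow> (nat \<Rightarrow> nat) set \<Rightarrow> bool" where
  "le_fin n A B \<longleftrightarrow>
     (\<exists>V e. uniformly_Pi n V \<and> B \<subseteq> (\<Union>i. V i) \<and> computable e \<and>
        (\<forall>i. \<forall>f \<in> B \<inter> V i. \<exists>g \<in> A. Phi_total (e i) f g))"

definition Muchnik_le :: "(nat \<Rightarrow> nat) set \<Rightarrow> (nat \<Rightarrow> nat) set \<Rightarrow> bool" where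
  "Muchnik_le A B \<longleftrightarrow> (\<forall>f \<in> B. \<exists>g \<in> A. \<exists>e. Phi_total e f g)"

text \<open>The index set \<open>\<omega> + 1\<close> is \<^typ>\<open>enat\<close>, with \<open>\<infinity>\<close> in the role of \<open>\<omega>\<close>.\<close>

definition mass_le :: "enat \<Rightarrow> (nat \<Rightarrow> nat) set \<Rightarrow> (nat \<Rightarrow> nat) set \<Rightarrow> bool" where
  "mass_le n A B = (case n of enat k \<Rightarrow> le_fin k A B | \<infinity> \<Rightarrow> Muchnik_le A B)"

end

(*
  Let E(f) be the set of all a such that a + 1 is the first component of some f(x), and let U n a be
  the Pi_n class with n alternating quantifiers over membership of tuples in E(f). It is universal in
  the following sense: given any h and any boldface Pi_n class Q, there is f whose second components
  are h and such that f is in U n 0 iff f is in Q. The definition of f refers to f itself, but the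
  matrix of Q needs finitely many values only, and a tuple may be enumerated as late as one likes.

  Take B = {f_k} and A = {b_k followed by h_k}, where b_k says whether f_k is in U n 0, and f_k is
  chosen as above against the k-th of the countably many candidate reductions (V, e) of level below n,
  with Q the class of all f such that no i with f in V_i yields first output value 0. The complement
  of Q is a boldface Sigma_n class, and the reduction must err at f_k, provided that the only element
  of A computable from f_k is its own. The map from h_k to f_k is continuous, so sufficiently generic
  h_k have this property. Working with boldface classes avoids any universal program.
*)

theory Submission
  imports Defs "HOL-Library.Countable_Set"
begin

subsection \<open>Programs for total functionals\<close>

abbreviation pr :: "nat \<Rightarrow> nat \<Rightarrow> nat" where "pr x y \<equiv> prod_encode (x, y)"
abbreviation pfst :: "nat \<Rightarrow> nat" where "pfst x \<equiv> fst (prod_decode x)"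
abbreviation psnd :: "nat \<Rightarrow> nat" where "psnd x \<equiv> snd (prod_decode x)"

lemma eval_Comp1: "eval f q xs z \<Longrightarrow> eval f p [z] y \<Longrightarrow> eval f (Comp p [q]) xs y"
  by (rule eval_Comp[where zs = "[z]"]) auto

lemma eval_Comp2:
  "eval f q xs z \<Longrightarrow> eval f q' xs z' \<Longrightarrow> eval f p [z, z'] y \<Longrightarrow> eval f (Comp p [q, q']) xs y"
  by (rule eval_Comp[where zs = "[z, z']"]) auto

lemma eval_Proj': "i < length xs \<Longrightarrow> y = xs ! i \<Longrightarrow> eval f (Proj i) xs y"
  using eval_Proj by simp

lemma eval_PRec_rec_nat:
  assumes "eval f p xs a" "\<And>n z. eval f q (n # z # xs) (s n z)"
  shows "eval f (PRec p q) (n # xs) (rec_nat a s n)"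
  by (induction n) (auto intro: eval_PRec_0 eval_PRec_Suc assms)

section \<open>Programs for arithmetic and for the pairing function\<close>

definition p_add :: prog where "p_add = PRec (Proj 0) (Comp Succ [Proj 1])"

lemma eval_add: "eval f p_add [n, x] (n + x)"
proof -
  have "rec_nat x (\<lambda>_ z. Suc z) n = n + x" by (induction n) auto
  moreover have "eval f p_add [n, x] (rec_nat x (\<lambda>_ z. Suc z) n)"
    unfolding p_add_def
    by (rule eval_PRec_rec_nat) (auto intro!: eval_Proj' eval_Comp1 eval_Succ)
  ultimately show ?thesis by simp
qed

definition p_pred :: prog where "p_pred = PRec Zero (Proj 0)"

lemma eval_pred: "eval f p_pred [n] (n - 1)"
proof -
  have "rec_nat 0 (\<lambda>m _. m) n = n - 1" by (cases n) auto
  moreover have "eval f p_pred [n] (rec_nat 0 (\<lambda>m _. m) n)"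
    unfolding p_pred_def
    by (rule eval_PRec_rec_nat) (auto intro!: eval_Proj' eval_Zero)
  ultimately show ?thesis by simp
qed

text \<open>Recursion runs on the first argument, so the subtrahend comes first.\<close>

definition p_sub :: prog where "p_sub = PRec (Proj 0) (Comp p_pred [Proj 1])"

lemma eval_sub: "eval f p_sub [n, x] (x - n)"
proof -
  have "rec_nat x (\<lambda>_ z. z - 1) n = x - n" by (induction n) auto
  moreover have "eval f p_sub [n, x] (rec_nat x (\<lambda>_ z. z - 1) n)"
    unfolding p_sub_def
    by (rule eval_PRec_rec_nat) (auto intro!: eval_Proj' eval_Comp1 eval_pred[simplified])
  ultimately show ?thesis by simp
qed

definition p_triangle :: prog where
  "p_triangle = PRec Zero (Comp p_add [Comp Succ [Proj 0], Proj 1])"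

lemma eval_triangle: "eval f p_triangle [n] (triangle n)"
proof -
  have "rec_nat 0 (\<lambda>m z. Suc m + z) n = triangle n" by (induction n) auto
  moreover have "eval f p_triangle [n] (rec_nat 0 (\<lambda>m z. Suc m + z) n)"
    unfolding p_triangle_def
    by (rule eval_PRec_rec_nat)
      (rule eval_Zero eval_Comp2 eval_Comp1 eval_Succ eval_Proj' eval_add | simp)+
  ultimately show ?thesis by simp
qed

definition p_pair :: prog where
  "p_pair = Comp p_add [Comp p_triangle [p_add], Proj 0]"

lemma eval_pair: "eval f p_pair [x, y] (pr x y)"
  unfolding p_pair_def prod_encode_def
  by (simp, rule eval_Comp2, rule eval_Comp1, rule eval_add, rule eval_triangle,
      rule eval_Proj', simp, rule refl, simp, rule eval_add)

lemma triangle_mono: "m \<le> n \<Longrightarrow> triangle m \<le> triangle n"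
  by (induction n) (auto simp: le_Suc_eq)

text \<open>
  The sum \<open>x + y\<close> is recovered from \<open>n = pr x y\<close> as the least \<open>k\<close> with \<open>n < triangle (k + 1)\<close>.
\<close>

definition p_root :: prog where
  "p_root = Mu (Comp p_sub [Comp p_triangle [Comp Succ [Proj 0]], Comp Succ [Proj 1]])"

lemma eval_root: "eval f p_root [n] (pfst n + psnd n)"
proof -
  let ?w = "pfst n + psnd n"
  have n: "n = triangle ?w + pfst n"
    using prod_decode_inverse[of n] unfolding prod_encode_def by (simp add: case_prod_beta)
  \<comment> \<open>With \<open>Suc n\<close> in place of \<open>n\<close>, the truncated difference
    vanishes exactly when \<open>n < triangle (Suc k)\<close>.\<close>
  let ?t = "Comp p_sub [Comp p_triangle [Comp Succ [Proj 0]], Comp Succ [Proj 1]]"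
  have t: "eval f ?t [k, n] (Suc n - triangle (Suc k))" for k
    by (rule eval_Comp2 eval_Comp1 eval_Succ eval_Proj' eval_sub eval_triangle | simp)+
  have "Suc n - triangle (Suc ?w) = 0" using n by simp
  then have "eval f ?t [?w, n] 0" using t[of ?w] by simp
  moreover have "\<exists>k. eval f ?t [m, n] (Suc k)" if "m < ?w" for m
  proof -
    have "triangle (Suc m) \<le> triangle ?w" using that by (intro triangle_mono) simp
    then have "Suc n - triangle (Suc m) = Suc (n - triangle (Suc m))" using n by linarith
    then show ?thesis using t[of m] by metis
  qed
  ultimately show ?thesis unfolding p_root_def by (blast intro: eval_Mu)
qed

definition p_fst :: prog where "p_fst = Comp p_sub [Comp p_triangle [p_root], Proj 0]"

lemma eval_fst: "eval f p_fst [n] (pfst n)"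
proof -
  let ?w = "pfst n + psnd n"
  have "n - triangle ?w = pfst n"
    using prod_decode_inverse[of n] unfolding prod_encode_def
    by (simp add: case_prod_beta)
  moreover have "eval f p_fst [n] (n - triangle ?w)"
    unfolding p_fst_def
    by (rule eval_Comp2 eval_Comp1 eval_root eval_Proj' eval_sub eval_triangle | simp)+
  ultimately show ?thesis by simp
qed

definition p_snd :: prog where "p_snd = Comp p_sub [p_fst, p_root]"

lemma eval_snd: "eval f p_snd [n] (psnd n)"
proof -
  have "eval f p_snd [n] ((pfst n + psnd n) - pfst n)"
    unfolding p_snd_def by (rule eval_Comp2 eval_root eval_fst eval_sub)+
  then show ?thesis by simp
qed

section \<open>Total functionals and their closure properties\<close>

text \<open>One program must halt on every oracle and every argument. Such functionals compose
  freely; several arguments are packed into one by pairing, and an oracle-free \<open>h\<close>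
  appears as a functional constant in the oracle.\<close>

definition tfun :: "((nat \<Rightarrow> nat) \<Rightarrow> nat \<Rightarrow> nat) \<Rightarrow> bool" where
  "tfun G \<longleftrightarrow> (\<exists>p. \<forall>f x. eval f p [x] (G f x))"

lemma tfun_id: "tfun (\<lambda>f x. x)"
  unfolding tfun_def by (rule exI[of _ "Proj 0"]) (simp add: eval_Proj')

lemma tfun_oracle: "tfun (\<lambda>f x. f x)"
  unfolding tfun_def using eval_Oracle by blast

lemma tfun_comp: "tfun G \<Longrightarrow> tfun H \<Longrightarrow> tfun (\<lambda>f x. G f (H f x))"
  unfolding tfun_def by (meson eval_Comp1)

lemma tfun_Suc: "tfun G \<Longrightarrow> tfun (\<lambda>f x. Suc (G f x))"
  unfolding tfun_def by (meson eval_Comp1 eval_Succ)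

lemma tfun_const: "tfun (\<lambda>f x. c)"
proof (induction c)
  case 0 show ?case unfolding tfun_def using eval_Zero by blast
next
  case (Suc c) then show ?case by (rule tfun_Suc)
qed

lemma tfun_pair: "tfun G \<Longrightarrow> tfun H \<Longrightarrow> tfun (\<lambda>f x. pr (G f x) (H f x))"
  unfolding tfun_def by (meson eval_Comp2 eval_pair)

lemma tfun_pfst: "tfun G \<Longrightarrow> tfun (\<lambda>f x. pfst (G f x))"
  unfolding tfun_def by (meson eval_Comp1 eval_fst)

lemma tfun_psnd: "tfun G \<Longrightarrow> tfun (\<lambda>f x. psnd (G f x))"
  unfolding tfun_def by (meson eval_Comp1 eval_snd)

text \<open>The value \<open>a f x\<close> is the parameter of the recursion. Step functions being
  unary, the parameter, the counter and the previous value reach \<open>s\<close> as one packed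
  triple.\<close>

lemma tfun_rec:
  assumes "tfun a" "tfun b" "tfun g" "tfun s"
  shows "tfun (\<lambda>f x. rec_nat (g f (a f x)) (\<lambda>n z. s f (pr (a f x) (pr n z))) (b f x))"
proof -
  obtain pa pb pg ps where p: "\<And>f x. eval f pa [x] (a f x)" "\<And>f x. eval f pb [x] (b f x)"
    "\<And>f x. eval f pg [x] (g f x)" "\<And>f x. eval f ps [x] (s f x)"
    using assms unfolding tfun_def by metis
  let ?q = "Comp ps [Comp p_pair [Proj 2, Comp p_pair [Proj 0, Proj 1]]]"
  have "eval f (PRec pg ?q) [n, y] (rec_nat (g f y) (\<lambda>n z. s f (pr y (pr n z))) n)" for f n y
    by (rule eval_PRec_rec_nat)
      (rule p eval_Comp1 eval_Comp2 eval_pair eval_Proj' | simp)+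
  then have "eval f (Comp (PRec pg ?q) [pb, pa]) [x]
      (rec_nat (g f (a f x)) (\<lambda>n z. s f (pr (a f x) (pr n z))) (b f x))" for f x
    by (rule eval_Comp2[OF p(2) p(1)])
  then show ?thesis unfolding tfun_def by blast
qed

text \<open>A case distinction is a recursion whose step ignores the previous value: no iteration
  yields \<open>g\<close>, any positive number of them yields \<open>h\<close>.\<close>

lemma tfun_if:
  assumes "tfun t" "tfun g" "tfun h"
  shows "tfun (\<lambda>f x. if t f x = 0 then g f x else h f x)"
proof -
  have "rec_nat a (\<lambda>_ _. b) n = (if n = 0 then a else b)" for a b n :: nat
    by (cases n) auto
  with tfun_rec[OF tfun_id assms(1,2) tfun_comp[OF assms(3) tfun_pfst[OF tfun_id]]]
  show ?thesis by simp
qed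

lemma tfun_pred: "tfun G \<Longrightarrow> tfun (\<lambda>f x. G f x - 1)"
  unfolding tfun_def by (meson eval_Comp1 eval_pred)

lemmas tfun_intros = tfun_id tfun_const tfun_Suc tfun_pair tfun_pfst tfun_psnd tfun_if tfun_pred

lemma tfun_computable: "tfun (\<lambda>f. h) \<Longrightarrow> computable h"
  unfolding tfun_def computable_def phi_def Phi_def by blast

section \<open>Hard-wired parameters\<close>

primrec p_num :: "nat \<Rightarrow> prog" where
  "p_num 0 = Zero"
| "p_num (Suc n) = Comp Succ [p_num n]"

lemma eval_num: "eval f (p_num n) xs n"
  by (induction n) (auto intro: eval_Zero eval_Comp1 eval_Succ)

lemma tfun_num_code: "tfun (\<lambda>f n. prog_code (p_num n))"
proof -
  \<comment> \<open>Here \<open>pr 0 0\<close> and \<open>pr 1 0\<close> code \<open>Zero\<close>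
    and \<open>Succ\<close>, the tag 4 belongs to \<open>Comp\<close>, and
    \<open>Suc (pr z 0)\<close> is the list code of \<open>[z]\<close>.\<close>
  have *: "prog_code (p_num n) =
      rec_nat (pr 0 0) (\<lambda>n z. pr 4 (pr (pr 1 0) (Suc (pr z 0)))) n" for n
    by (induction n) auto
  have "tfun (\<lambda>f x. rec_nat ((\<lambda>f x. pr 0 0) f ((\<lambda>f x. x) f x))
     (\<lambda>n z. (\<lambda>f y. pr 4 (pr (pr 1 0) (Suc (pr (psnd (psnd y)) 0)))) f (pr ((\<lambda>f x. x) f x) (pr n z))) x)"
    by (rule tfun_rec) (rule tfun_intros)+
  then show ?thesis unfolding * by simp
qed

text \<open>The s-m-n theorem: the numeral for \<open>a\<close> is built into the program
  \<open>P a\<close>, whose code is a total computable function of \<open>a\<close>.\<close>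

lemma smn:
  assumes "tfun (\<lambda>f. h)"
  obtains idx where "tfun (\<lambda>f. idx)" "\<And>a j. phi (idx a) j (h (pr a j))"
proof -
  obtain q where q: "\<And>f x. eval f q [x] (h x)" using assms unfolding tfun_def by blast
  define P where "P a = Comp q [Comp p_pair [p_num a, Proj 0]]" for a
  have "eval f (P a) [j] (h (pr a j))" for f a j
    unfolding P_def by (rule q eval_Comp1 eval_Comp2 eval_pair eval_num eval_Proj' | simp)+
  then have "phi (prog_code (P a)) j (h (pr a j))" for a j
    unfolding phi_def Phi_def by blast
  moreover have "tfun (\<lambda>f a. prog_code (P a))"
    unfolding P_def by (simp, (rule tfun_intros tfun_num_code)+)
  ultimately show ?thesis using that by blast
qed

subsection \<open>Uniform sequences of effective classes\<close>

text \<open>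
  A form of uniformity that keeps the indices of all intermediate classes as one total function of
  the tuple of quantified variables. Unlike \<open>uniformly_Pi\<close>, it passes from level \<open>n\<close> to level
  \<open>n + 1\<close> without a universal program.
\<close>

primrec unif_Pi :: "nat \<Rightarrow> (nat \<Rightarrow> (nat \<Rightarrow> nat) set) \<Rightarrow> bool" where
  "unif_Pi 0 X \<longleftrightarrow> (\<exists>h. tfun (\<lambda>f. h) \<and> (\<forall>a. Pi_index 0 (h a) (X a)))"
| "unif_Pi (Suc n) X \<longleftrightarrow> (\<exists>W. unif_Pi n W \<and> (\<forall>a. X a = (\<Inter>j. - W (pr a j))))"

text \<open>At each level, s-m-n turns the function indexing all \<open>W (pr a j)\<close> into
  indices, computable from \<open>a\<close>, of the functions of \<open>j\<close> alone.\<close>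

lemma unif_Pi_index:
  "unif_Pi n X \<Longrightarrow> \<exists>h. tfun (\<lambda>f. h) \<and> (\<forall>a. Pi_index n (h a) (X a))"
proof (induction n arbitrary: X)
  case 0 then show ?case by simp
next
  case (Suc n)
  then obtain W where W: "unif_Pi n W" "\<And>a. X a = (\<Inter>j. - W (pr a j))" by auto
  from Suc.IH[OF W(1)] obtain h where h: "tfun (\<lambda>f. h)" "\<And>a. Pi_index n (h a) (W a)" by blast
  from smn[OF h(1)] obtain idx
    where idx: "tfun (\<lambda>f. idx)" "\<And>a j. phi (idx a) j (h (pr a j))" by metis
  have "Pi_index (Suc n) (idx a) (X a)" for a
    unfolding Pi_index.simps using idx(2) h(2) W(2)
    by (intro exI[of _ "\<lambda>j. W (pr a j)"]) blast
  with idx(1) show ?case by blast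
qed

lemma unif_Pi_uniformly_Pi: "unif_Pi n X \<Longrightarrow> uniformly_Pi n X"
  unfolding uniformly_Pi_def using unif_Pi_index tfun_computable by blast

text \<open>At level 0 complements stay at level 0, so a class is an intersection over a dummy
  variable of its double complement. Higher levels raise the inner sequence instead.\<close>

lemma unif_Pi_Suc: "unif_Pi n X \<Longrightarrow> unif_Pi (Suc n) X"
proof (induction n arbitrary: X)
  case 0
  then obtain h where h: "tfun (\<lambda>f. h)" "\<And>a. Pi_index 0 (h a) (X a)" by auto
  have "tfun (\<lambda>f a. pr 1 (h (pfst a)))"
    by (rule tfun_intros tfun_comp[OF h(1)])+
  moreover have "Pi_index 0 (pr 1 (h (pfst a))) (- X (pfst a))" for a
  proof -
    obtain b where "h (pfst a) = bcomb_code b" "X (pfst a) = bcomb_set b"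
      using h(2)[of "pfst a"] by auto
    then show ?thesis by (auto intro!: exI[of _ "Neg b"])
  qed
  ultimately have "unif_Pi 0 (\<lambda>a. - X (pfst a))" unfolding unif_Pi.simps by blast
  then show ?case by (auto intro!: exI[of _ "\<lambda>a. - X (pfst a)"])
next
  case (Suc n)
  from Suc.prems obtain W where "unif_Pi n W" "\<forall>a. X a = (\<Inter>j. - W (pr a j))" by auto
  with Suc.IH have "unif_Pi (Suc n) W" "\<forall>a. X a = (\<Inter>j. - W (pr a j))" by blast+
  then show ?case unfolding unif_Pi.simps(2)[of "Suc n"] by blast
qed

lemma unif_Pi_subst: "unif_Pi n X \<Longrightarrow> tfun (\<lambda>f. s) \<Longrightarrow> unif_Pi n (\<lambda>a. X (s a))"
proof (induction n arbitrary: X s)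
  case 0
  then obtain h where h: "tfun (\<lambda>f. h)" "\<And>a. Pi_index 0 (h a) (X a)" by auto
  with tfun_comp[OF h(1) 0(2)] show ?case by auto
next
  case (Suc n)
  from Suc.prems obtain W where W: "unif_Pi n W" "\<And>a. X a = (\<Inter>j. - W (pr a j))" by auto
  have "tfun (\<lambda>f b. pr (s (pfst b)) (psnd b))"
    by (rule tfun_intros tfun_comp[OF Suc.prems(2)])+
  from Suc.IH[OF W(1) this] W(2) show ?case
    by (auto intro!: exI[of _ "\<lambda>b. W (pr (s (pfst b)) (psnd b))"])
qed

text \<open>This merges a class and a cover of its complement into one uniform sequence.\<close>

lemma unif_Pi_if:
  "unif_Pi n X \<Longrightarrow> unif_Pi n Y \<Longrightarrow> tfun (\<lambda>f. t) \<Longrightarrow> unif_Pi n (\<lambda>a. if t a = 0 then X a else Y a)"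
proof (induction n arbitrary: X Y t)
  case 0
  then obtain h h' where h: "tfun (\<lambda>f. h)" "\<And>a. Pi_index 0 (h a) (X a)"
    "tfun (\<lambda>f. h')" "\<And>a. Pi_index 0 (h' a) (Y a)" by auto
  have "Pi_index 0 (if t a = 0 then h a else h' a) (if t a = 0 then X a else Y a)" for a
    using h(2,4) by simp
  with tfun_if[OF 0(3) h(1) h(3)] show ?case unfolding unif_Pi.simps by blast
next
  case (Suc n)
  from Suc.prems obtain W W' where W: "unif_Pi n W" "\<And>a. X a = (\<Inter>j. - W (pr a j))"
    "unif_Pi n W'" "\<And>a. Y a = (\<Inter>j. - W' (pr a j))" by auto
  have "tfun (\<lambda>f b. t (pfst b))"
    by (rule tfun_intros tfun_comp[OF Suc.prems(3)])+
  from Suc.IH[OF W(1,3) this] W(2,4) show ?case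
    by (auto intro!: exI[of _ "\<lambda>b. if t (pfst b) = 0 then W b else W' b"])
qed

section \<open>Words ending in a given entry, and the universal classes\<close>

text \<open>Iterated unpairing reads every number as an infinite sequence; any finite sequence is an
  initial segment of one of these.\<close>

definition digit :: "nat \<Rightarrow> nat \<Rightarrow> nat" where
  "digit s i = pfst ((psnd ^^ i) s)"

lemma digit_surj: "\<exists>s. \<forall>i<k. digit s i = g i"
proof (induction k arbitrary: g)
  case 0 show ?case by simp
next
  case (Suc k)
  obtain s where s: "\<And>i. i < k \<Longrightarrow> digit s i = g (Suc i)" using Suc[of "\<lambda>i. g (Suc i)"] by auto
  have "digit (pr (g 0) s) i = g i" if "i < Suc k" for i
    using that s by (cases i) (auto simp: digit_def funpow_Suc_right simp del: funpow.simps(2))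
  then show ?case by blast
qed

text \<open>
  For fixed \<open>a\<close>, the words \<open>word (pr a (pr y (pr s k)))\<close> are exactly those ending in a pair with
  first component \<open>a + 1\<close>; the reversal of the digits lets their codes be built by primitive recursion.
\<close>

definition word :: "nat \<Rightarrow> nat list" where
  "word b = map (digit (pfst (psnd (psnd b)))) (rev [0..<psnd (psnd (psnd b))])
     @ [pr (Suc (pfst b)) (pfst (psnd b))]"

lemma tfun_word_code: "tfun (\<lambda>f b. list_encode (word b))"
proof -
  define S where "S x = rec_nat (pfst x) (\<lambda>n z. psnd z) (psnd x)" for x
  have S: "S (pr s k) = (psnd ^^ k) s" for s k unfolding S_def by (induction k) auto
  have "tfun (\<lambda>f x. rec_nat ((\<lambda>f y. pfst y) f ((\<lambda>f x. x) f x))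
     (\<lambda>n z. (\<lambda>f y. psnd (psnd (psnd y))) f (pr ((\<lambda>f x. x) f x) (pr n z))) (psnd x))"
    by (rule tfun_rec) (rule tfun_intros)+
  then have tS: "tfun (\<lambda>f. S)" by (simp add: S_def[abs_def])
  \<comment> \<open>The recursion starts from the code of the final one-entry list and prepends
    digit \<open>n\<close> at step \<open>n\<close>, since the code of \<open>x # xs\<close> is
    \<open>Suc\<close> of a pair.\<close>
  define R where "R b k = rec_nat (Suc (pr (pr (Suc (pfst b)) (pfst (psnd b))) 0))
     (\<lambda>n z. Suc (pr (pfst (S (pr (pfst (psnd (psnd b))) n))) z)) k" for b k
  have "tfun (\<lambda>f b. rec_nat
      ((\<lambda>f b. Suc (pr (pr (Suc (pfst b)) (pfst (psnd b))) 0)) f ((\<lambda>f x. x) f b))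
     (\<lambda>n z. (\<lambda>f y. Suc (pr (pfst (S (pr (pfst (psnd (psnd (pfst y)))) (pfst (psnd y)))))
        (psnd (psnd y)))) f (pr ((\<lambda>f x. x) f b) (pr n z))) (psnd (psnd (psnd b))))"
    by (rule tfun_rec) (rule tfun_intros tfun_comp[OF tS])+
  then have "tfun (\<lambda>f b. R b (psnd (psnd (psnd b))))" by (simp add: R_def)
  moreover have "R b k = list_encode (map (digit (pfst (psnd (psnd b)))) (rev [0..<k])
     @ [pr (Suc (pfst b)) (pfst (psnd b))])" for b k
    by (induction k) (auto simp: R_def S digit_def)
  ultimately show ?thesis by (simp add: word_def)
qed

text \<open>The shape of a class with \<open>n\<close> alternating quantifiers over the matrix
  \<open>M\<close>. Keeping \<open>M\<close> arbitrary allows \<open>U\<close> and a boldface class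
  to be compared level by level.\<close>

primrec alt :: "(nat \<Rightarrow> 'a set) \<Rightarrow> nat \<Rightarrow> nat \<Rightarrow> 'a set" where
  "alt M 0 a = M a"
| "alt M (Suc n) a = (\<Inter>j. - alt M n (pr a j))"

abbreviation U :: "nat \<Rightarrow> nat \<Rightarrow> (nat \<Rightarrow> nat) set" where
  "U \<equiv> alt (\<lambda>a. cylinder (word a))"

lemma unif_Pi_U: "unif_Pi n (U n)"
proof (induction n)
  case 0
  have "tfun (\<lambda>f b. pr 0 (list_encode (word b)))" by (rule tfun_intros tfun_word_code)+
  then show ?case
    by (auto intro!: exI[of _ "\<lambda>b. pr 0 (list_encode (word b))"] exI[of _ "Cyl _"])
next
  case (Suc n) then show ?case by auto
qed

text \<open>The innermost variable runs over all words ending in an entry for \<open>a\<close>, so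
  some cylinder contains \<open>f\<close> iff \<open>a\<close> is enumerated somewhere in
  \<open>f\<close>.\<close>

lemma U_1: "U (Suc 0) a = {f. \<forall>x. pfst (f x) \<noteq> Suc a}"
proof -
  have "(\<exists>j. f \<in> cylinder (word (pr a j))) \<longleftrightarrow> (\<exists>x. pfst (f x) = Suc a)" for f
  proof
    assume "\<exists>j. f \<in> cylinder (word (pr a j))"
    then obtain j where j: "f \<in> cylinder (word (pr a j))" ..
    let ?k = "psnd (psnd j)"
    have "f ?k = word (pr a j) ! ?k" using j unfolding cylinder_def word_def by simp
    also have "\<dots> = pr (Suc a) (pfst j)" unfolding word_def by (simp add: nth_append)
    finally show "\<exists>x. pfst (f x) = Suc a" by (auto intro!: exI[of _ ?k])
  next
    assume "\<exists>x. pfst (f x) = Suc a"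
    then obtain x where x: "pfst (f x) = Suc a" ..
    \<comment> \<open>The index is reversed because \<open>word\<close> lists its digits
      backwards.\<close>
    obtain s where s: "\<And>i. i < x \<Longrightarrow> digit s i = f (x - Suc i)"
      using digit_surj[of x "\<lambda>i. f (x - Suc i)"] by blast
    have "pr (Suc a) (psnd (f x)) = f x" using x by (metis prod.collapse prod_decode_inverse)
    then have "f \<in> cylinder (word (pr a (pr (psnd (f x)) (pr s x))))"
      by (auto simp: cylinder_def word_def nth_append rev_nth s less_Suc_eq)
    then show "\<exists>j. f \<in> cylinder (word (pr a j))" by blast
  qed
  then show ?thesis by auto
qed

subsection \<open>Boldface classes\<close>

definition opn :: "(nat \<Rightarrow> nat) set \<Rightarrow> bool" where
  "opn X \<longleftrightarrow> (\<forall>f\<in>X. \<exists>N. \<forall>f'. (\<forall>i<N. f' i = f i) \<longrightarrow> f' \<in> X)"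

lemma opnD: "opn X \<Longrightarrow> f \<in> X \<Longrightarrow> \<exists>N. \<forall>f'. (\<forall>i<N. f' i = f i) \<longrightarrow> f' \<in> X"
  unfolding opn_def by blast

lemma opn_UN:
  assumes "\<And>i. i \<in> I \<Longrightarrow> opn (X i)" shows "opn (\<Union>i\<in>I. X i)"
  unfolding opn_def
proof
  fix f assume "f \<in> (\<Union>i\<in>I. X i)"
  then obtain i where i: "i \<in> I" "f \<in> X i" by blast
  then obtain N where "\<forall>f'. (\<forall>j<N. f' j = f j) \<longrightarrow> f' \<in> X i"
    using assms unfolding opn_def by blast
  with i(1) show "\<exists>N. \<forall>f'. (\<forall>j<N. f' j = f j) \<longrightarrow> f' \<in> (\<Union>i\<in>I. X i)" by blast
qed

lemma opn_Int:
  assumes "opn X" "opn Y" shows "opn (X \<inter> Y)"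
  unfolding opn_def
proof
  fix f assume "f \<in> X \<inter> Y"
  then obtain M N where "\<forall>f'. (\<forall>i<M. f' i = f i) \<longrightarrow> f' \<in> X" "\<forall>f'. (\<forall>i<N. f' i = f i) \<longrightarrow> f' \<in> Y"
    using assms unfolding opn_def by blast
  then have "\<forall>f'. (\<forall>i<max M N. f' i = f i) \<longrightarrow> f' \<in> X \<inter> Y" by simp
  then show "\<exists>N. \<forall>f'. (\<forall>i<N. f' i = f i) \<longrightarrow> f' \<in> X \<inter> Y" by blast
qed

lemma opn_Un: "opn X \<Longrightarrow> opn Y \<Longrightarrow> opn (X \<union> Y)"
  unfolding opn_def by (metis Un_iff)

lemma opn_cylinder: "opn (cylinder \<sigma>)"
  unfolding opn_def cylinder_def by (auto intro!: exI[of _ "length \<sigma>"])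

lemma opn_Compl_cylinder: "opn (- cylinder \<sigma>)"
  unfolding opn_def
proof
  fix f assume "f \<in> - cylinder \<sigma>"
  then obtain i where i: "i < length \<sigma>" "f i \<noteq> \<sigma> ! i" unfolding cylinder_def by auto
  then have "\<forall>f'. (\<forall>j<Suc i. f' j = f j) \<longrightarrow> f' \<in> - cylinder \<sigma>" unfolding cylinder_def by auto
  then show "\<exists>N. \<forall>f'. (\<forall>i<N. f' i = f i) \<longrightarrow> f' \<in> - cylinder \<sigma>" by blast
qed

lemma opn_value: "opn {f. f i = c}"
  unfolding opn_def by (auto intro!: exI[of _ "Suc i"])

section \<open>Continuity of oracle computations\<close>

lemma common_use:
  assumes "\<And>m. m < n \<Longrightarrow> \<exists>N. \<forall>f'. (\<forall>i<N. f' i = f i) \<longrightarrow> P m f'"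
  shows "\<exists>N::nat. \<forall>m<n::nat. \<forall>f'. (\<forall>i<N. f' i = f i) \<longrightarrow> P m f'"
  using assms
proof (induction n)
  case 0 show ?case by simp
next
  case (Suc n)
  have "\<exists>N. \<forall>m<n. \<forall>f'. (\<forall>i<N. f' i = f i) \<longrightarrow> P m f'"
    by (rule Suc.IH) (rule Suc.prems, simp)
  then obtain N where N: "\<forall>m<n. \<forall>f'. (\<forall>i<N. f' i = f i) \<longrightarrow> P m f'" ..
  obtain M where M: "\<forall>f'. (\<forall>i<M. f' i = f i) \<longrightarrow> P n f'"
    using Suc.prems[OF lessI] ..
  have "P m f'" if "m < Suc n" "\<forall>i<max N M. f' i = f i" for m f'
  proof (cases "m = n")
    case True with that M show ?thesis by simp
  next
    case False with that N show ?thesis by simp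
  qed
  then show ?case by (intro exI[of _ "max N M"]) simp
qed

text \<open>The use principle: a halting computation consults finitely many oracle values.
  \<open>Comp\<close> and \<open>Mu\<close> depend on several computations at once, whose uses are
  bounded together by \<open>common_use\<close>.\<close>

lemma eval_finite_use:
  "eval f p xs y \<Longrightarrow> \<exists>N. \<forall>f'. (\<forall>i<N. f' i = f i) \<longrightarrow> eval f' p xs y"
proof (induction rule: eval.induct)
  case (eval_Zero xs) then show ?case by (blast intro: eval.eval_Zero)
next
  case (eval_Succ x) then show ?case by (blast intro: eval.eval_Succ)
next
  case (eval_Proj i xs) then show ?case by (blast intro: eval.eval_Proj)
next
  case (eval_Oracle x)
  have "eval f' Oracle [x] (f x)" if "\<forall>i<Suc x. f' i = f i" for f'
    using that eval.eval_Oracle[of f' x] by simp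
  then show ?case by blast
next
  case (eval_Comp xs qs zs p y)
  then obtain N where N: "\<forall>f'. (\<forall>i<N. f' i = f i) \<longrightarrow> eval f' p zs y" by blast
  have len: "length qs = length zs" using eval_Comp.IH(1) by (rule list_all2_lengthD)
  have "\<exists>M. \<forall>m<length qs. \<forall>f'. (\<forall>i<M. f' i = f i) \<longrightarrow> eval f' (qs ! m) xs (zs ! m)"
    by (rule common_use) (use eval_Comp.IH(1) in \<open>simp add: list_all2_conv_all_nth\<close>)
  then obtain M where M: "\<forall>m<length qs. \<forall>f'. (\<forall>i<M. f' i = f i) \<longrightarrow> eval f' (qs ! m) xs (zs ! m)" ..
  have "eval f' (Comp p qs) xs y" if "\<forall>i<max M N. f' i = f i" for f'
    by (rule eval.eval_Comp[of _ _ _ zs]) (use that M N len in \<open>auto simp: list_all2_conv_all_nth\<close>)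
  then show ?case by blast
next
  case (eval_PRec_0 p xs y q) then show ?case by (meson eval.eval_PRec_0)
next
  case (eval_PRec_Suc p q n xs z y)
  then obtain M N where "\<forall>f'. (\<forall>i<M. f' i = f i) \<longrightarrow> eval f' (PRec p q) (n # xs) z"
    "\<forall>f'. (\<forall>i<N. f' i = f i) \<longrightarrow> eval f' q (n # z # xs) y" by blast
  then have "\<forall>f'. (\<forall>i<max M N. f' i = f i) \<longrightarrow> eval f' (PRec p q) (Suc n # xs) y"
    by (intro allI impI eval.eval_PRec_Suc[where z = z]) auto
  then show ?case by blast
next
  case (eval_Mu p n xs)
  then obtain N where N: "\<forall>f'. (\<forall>i<N. f' i = f i) \<longrightarrow> eval f' p (n # xs) 0" by blast
  have "\<exists>M. \<forall>m<n. \<forall>f'. (\<forall>i<M. f' i = f i) \<longrightarrow> (\<exists>k. eval f' p (m # xs) (Suc k))"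
  proof (rule common_use)
    fix m assume "m < n"
    with eval_Mu.IH(2) obtain k N
      where "\<forall>f'. (\<forall>i<N. f' i = f i) \<longrightarrow> eval f' p (m # xs) (Suc k)" by blast
    then show "\<exists>N. \<forall>f'. (\<forall>i<N. f' i = f i) \<longrightarrow> (\<exists>k. eval f' p (m # xs) (Suc k))"
      by (intro exI[of _ N]) blast
  qed
  then obtain M where
    M: "\<forall>m<n. \<forall>f'. (\<forall>i<M. f' i = f i) \<longrightarrow> (\<exists>k. eval f' p (m # xs) (Suc k))" ..
  have "eval f' (Mu p) xs n" if "\<forall>i<max M N. f' i = f i" for f'
  proof (rule eval.eval_Mu)
    show "eval f' p (n # xs) 0" using that N by simp
    have "\<forall>i<M. f' i = f i" using that by simp
    with M show "\<forall>m<n. \<exists>k. eval f' p (m # xs) (Suc k)" by blast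
  qed
  then show ?case by blast
qed

lemma opn_Phi: "opn {f. Phi e f x y}"
  unfolding opn_def
proof
  fix f assume "f \<in> {f. Phi e f x y}"
  then obtain p where p: "e = prog_code p" "eval f p [x] y" unfolding Phi_def by blast
  from eval_finite_use[OF p(2)] p(1)
  show "\<exists>N. \<forall>f'. (\<forall>i<N. f' i = f i) \<longrightarrow> f' \<in> {f. Phi e f x y}"
    unfolding Phi_def by blast
qed

section \<open>The boldface hierarchy over clopen sets\<close>

primrec bold_Pi :: "nat \<Rightarrow> (nat \<Rightarrow> nat) set \<Rightarrow> bool" where
  "bold_Pi 0 X \<longleftrightarrow> opn X \<and> opn (- X)"
| "bold_Pi (Suc n) X \<longleftrightarrow> (\<exists>W. (\<forall>j::nat. bold_Pi n (W j)) \<and> X = (\<Inter>j. - W j))"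

lemma bold_Pi_Suc: "bold_Pi n X \<Longrightarrow> bold_Pi (Suc n) X"
proof (induction n arbitrary: X)
  case 0 then show ?case by (auto intro!: exI[of _ "\<lambda>j. - X"])
next
  case (Suc n)
  from Suc.prems obtain W where W: "\<forall>j::nat. bold_Pi n (W j)" "X = (\<Inter>j. - W j)" by auto
  with Suc.IH have "\<forall>j. bold_Pi (Suc n) (W j)" by blast
  with W(2) show ?case unfolding bold_Pi.simps(2)[of "Suc n"] by blast
qed

lemma bold_Pi_mono: "m \<le> n \<Longrightarrow> bold_Pi m X \<Longrightarrow> bold_Pi n X"
  by (induction n rule: dec_induct) (auto intro: bold_Pi_Suc simp del: bold_Pi.simps)

text \<open>The two intersections are interleaved, even indices serving \<open>X\<close> and odd
  ones \<open>Y\<close>.\<close>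

lemma bold_Pi_Int: "bold_Pi n X \<Longrightarrow> bold_Pi n Y \<Longrightarrow> bold_Pi n (X \<inter> Y)"
proof (cases n)
  case 0
  assume "bold_Pi n X" "bold_Pi n Y"
  with 0 show ?thesis by (auto simp: opn_Int opn_Un Compl_Int)
next
  case (Suc k)
  assume "bold_Pi n X" "bold_Pi n Y"
  with Suc obtain W W' where W: "\<And>j::nat. bold_Pi k (W j)" "X = (\<Inter>j. - W j)"
    "\<And>j::nat. bold_Pi k (W' j)" "Y = (\<Inter>j. - W' j)" by auto
  let ?Z = "\<lambda>j. if even j then W (j div 2) else W' (j div 2)"
  have "?Z (2 * j) = W j" "?Z (2 * j + 1) = W' j" for j by auto
  then have "X \<inter> Y = (\<Inter>j. - ?Z j)" unfolding W(2,4) by (auto; metis)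
  moreover have "bold_Pi k (?Z j)" for j using W by simp
  ultimately show ?thesis unfolding Suc bold_Pi.simps by (intro exI[of _ ?Z] conjI allI)
qed

lemma bold_Pi_0_bcomb_set: "bold_Pi 0 (bcomb_set b)"
  by (induction b) (auto simp: opn_cylinder opn_Compl_cylinder opn_Int opn_Un Compl_Int)

lemma bold_Pi_Pi_index: "Pi_index n e V \<Longrightarrow> bold_Pi n V"
proof (induction n arbitrary: e V)
  case 0 then show ?case using bold_Pi_0_bcomb_set by auto
next
  case (Suc n) then show ?case by (auto; metis)
qed

lemma opn_eq_UN_cylinder: "opn X \<Longrightarrow> X = (\<Union>\<sigma>\<in>{\<sigma>. cylinder \<sigma> \<subseteq> X}. cylinder \<sigma>)"
proof (intro equalityI subsetI)
  fix f assume "opn X" "f \<in> X"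
  then obtain N where "\<forall>f'. (\<forall>i<N. f' i = f i) \<longrightarrow> f' \<in> X" unfolding opn_def by blast
  then have "cylinder (map f [0..<N]) \<subseteq> X" "f \<in> cylinder (map f [0..<N])"
    by (auto simp: cylinder_def)
  then show "f \<in> (\<Union>\<sigma>\<in>{\<sigma>. cylinder \<sigma> \<subseteq> X}. cylinder \<sigma>)" by blast
qed auto

text \<open>An open set is a countable union of cylinders. The union thus becomes a countable union
  of classes \<open>V i \<inter> C i s\<close> of a level \<open>k\<close> with
  \<open>n = Suc k\<close>, and its complement has level \<open>n\<close>.\<close>

lemma bold_Pi_Compl_UN:
  assumes "m < n" "\<And>i::nat. bold_Pi m (V i)" "\<And>i. opn (X i)"
  shows "bold_Pi n (- (\<Union>i. V i \<inter> X i))"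
proof -
  obtain k where n: "n = Suc k" "m \<le> k" using assms(1) by (cases n) auto
  \<comment> \<open>The empty set is the default for codes of words whose cylinder is not inside
    \<open>X i\<close>.\<close>
  define C where "C i s = (if cylinder (list_decode s) \<subseteq> X i then cylinder (list_decode s) else {})"
    for i s
  have "bold_Pi 0 (C i s)" for i s
    unfolding C_def by (auto simp: opn_cylinder opn_Compl_cylinder) (auto simp: opn_def)
  then have C: "bold_Pi k (C i s)" for i s using bold_Pi_mono by blast
  have X: "X i = (\<Union>s. C i s)" for i
  proof -
    have "(\<Union>s. C i s) = (\<Union>\<sigma>\<in>{\<sigma>. cylinder \<sigma> \<subseteq> X i}. cylinder \<sigma>)"
      unfolding C_def by (auto split: if_splits) (metis list_encode_inverse)
    then show ?thesis using opn_eq_UN_cylinder[OF assms(3)] by metis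
  qed
  let ?W = "\<lambda>j. V (pfst j) \<inter> C (pfst j) (psnd j)"
  have "f \<in> (\<Union>i. V i \<inter> X i) \<longleftrightarrow> (\<exists>j. f \<in> ?W j)" for f
  proof
    assume "f \<in> (\<Union>i. V i \<inter> X i)"
    then obtain i s where "f \<in> V i" "f \<in> C i s" using X by auto
    then have "f \<in> ?W (pr i s)" by simp
    then show "\<exists>j. f \<in> ?W j" by blast
  qed (use X in blast)
  then have "- (\<Union>i. V i \<inter> X i) = (\<Inter>j. - ?W j)" by auto
  moreover have "bold_Pi k (?W j)" for j
    using C assms(2) bold_Pi_mono[OF n(2)] by (intro bold_Pi_Int) blast+
  ultimately show ?thesis unfolding n(1) bold_Pi.simps by (intro exI[of _ ?W] conjI allI)
qed

text \<open>A normal form: the choices at all levels are collected into one clopen matrix on tuples.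
  The induction needs a whole family \<open>Q\<close>, as all the \<open>W a j\<close> must share a
  matrix.\<close>

lemma bold_Pi_alt:
  "(\<And>a. bold_Pi n (Q a)) \<Longrightarrow> \<exists>M. (\<forall>a. bold_Pi 0 (M a)) \<and> (\<forall>a. Q a = alt M n a)"
proof (induction n arbitrary: Q)
  case 0 then show ?case by (intro exI[of _ Q]) simp
next
  case (Suc n)
  then have "\<forall>a. \<exists>W. (\<forall>j::nat. bold_Pi n (W j)) \<and> Q a = (\<Inter>j. - W j)" by simp
  then obtain W where W: "\<And>a j::nat. bold_Pi n (W a j)" "\<And>a. Q a = (\<Inter>j. - W a j)" by metis
  obtain M where M: "\<forall>a. bold_Pi 0 (M a)" "\<And>b. W (pfst b) (psnd b) = alt M n b"
    using Suc.IH[of "\<lambda>b. W (pfst b) (psnd b)"] W(1) by blast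
  have "W a j = alt M n (pr a j)" for a j using M(2)[of "pr a j"] by simp
  then have "Q a = alt M (Suc n) a" for a using W(2) by simp
  with M(1) show ?case by blast
qed

subsection \<open>Diagonalisation\<close>

text \<open>
  In a prefix of \<open>diag X h\<close>, the second components copy \<open>h\<close>, and stage \<open>x\<close> enumerates \<open>a = pfst x\<close>
  (as \<open>a + 1\<close>, with \<open>0\<close> for no entry) once the prefix already forces membership in \<open>X a\<close>. As \<open>pfst\<close>
  takes each value at arbitrarily late stages, no membership is missed, although \<open>X a\<close> is evaluated
  at the very sequence being built.
\<close>

primrec diag_pre :: "(nat \<Rightarrow> (nat \<Rightarrow> nat) set) \<Rightarrow> (nat \<Rightarrow> nat) \<Rightarrow> nat \<Rightarrow> nat list" where
  "diag_pre X h 0 = []"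
| "diag_pre X h (Suc x) = diag_pre X h x @
     [pr (if cylinder (diag_pre X h x) \<subseteq> X (pfst x) then Suc (pfst x) else 0) (h x)]"

definition diag :: "(nat \<Rightarrow> (nat \<Rightarrow> nat) set) \<Rightarrow> (nat \<Rightarrow> nat) \<Rightarrow> nat \<Rightarrow> nat" where
  "diag X h x = last (diag_pre X h (Suc x))"

lemma diag_pre_eq: "diag_pre X h x = map (diag X h) [0..<x]"
  by (induction x) (auto simp: diag_def)

lemma psnd_diag: "psnd (diag X h x) = h x"
  by (simp add: diag_def)

text \<open>Entry \<open>x\<close> depends only on the values of \<open>h\<close> up to
  \<open>x\<close>; this continuity is what the genericity argument uses.\<close>

lemma diag_local: "\<forall>i<N. h' i = h i \<Longrightarrow> x < N \<Longrightarrow> diag X h' x = diag X h x"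
proof -
  assume h: "\<forall>i<N. h' i = h i" and x: "x < N"
  have "diag_pre X h' y = diag_pre X h y" if "y \<le> N" for y
    using that by (induction y) (auto simp: h)
  with x show ?thesis unfolding diag_def by (metis Suc_leI)
qed

lemma diag_enumerates:
  assumes "opn (X a)"
  shows "(\<exists>x. pfst (diag X h x) = Suc a) \<longleftrightarrow> diag X h \<in> X a"
proof
  assume "\<exists>x. pfst (diag X h x) = Suc a"
  then obtain x where "pfst (diag X h x) = Suc a" ..
  then have "cylinder (diag_pre X h x) \<subseteq> X a"
    by (auto simp: diag_def split: if_splits)
  moreover have "diag X h \<in> cylinder (diag_pre X h x)"
    unfolding diag_pre_eq by (simp add: cylinder_def)
  ultimately show "diag X h \<in> X a" by blast
next
  assume "diag X h \<in> X a"
  then obtain N where N: "\<forall>f'. (\<forall>i<N. f' i = diag X h i) \<longrightarrow> f' \<in> X a"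
    using assms unfolding opn_def by blast
  \<comment> \<open>A stage devoted to \<open>a\<close> that comes no earlier than
    \<open>N\<close>.\<close>
  let ?x = "pr a N"
  have "N \<le> ?x" by (rule le_prod_encode_2)
  with N have "cylinder (diag_pre X h ?x) \<subseteq> X a"
    unfolding diag_pre_eq by (auto simp: cylinder_def)
  then have "pfst (diag X h ?x) = Suc a" by (simp add: diag_def)
  then show "\<exists>x. pfst (diag X h x) = Suc a" ..
qed

lemma diag_U:
  assumes "n > 0" "bold_Pi n Q"
  obtains F where "\<And>h x. psnd (F h x) = h x"
    "\<And>h h' N x. \<forall>i<N. h' i = h i \<Longrightarrow> x < N \<Longrightarrow> F h' x = F h x"
    "\<And>h. F h \<in> U n 0 \<longleftrightarrow> F h \<in> Q"
proof -
  obtain k where n: "n = Suc k" using assms(1) by (cases n) auto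
  obtain M where M: "\<And>a. bold_Pi 0 (M a)" "\<And>a. Q = alt M n a"
    using bold_Pi_alt[of n "\<lambda>_. Q"] assms(2) by metis
  \<comment> \<open>The union absorbs the innermost variable and is open. Enumeration settles level
    one, and the outer alternations then agree on both sides.\<close>
  define X where "X a = (\<Union>j. M (pr a j))" for a
  have X: "opn (X a)" for a unfolding X_def using M(1) by (intro opn_UN) simp
  have "diag X h \<in> U (Suc m) a \<longleftrightarrow> diag X h \<in> alt M (Suc m) a" for h m a
  proof (induction m arbitrary: a)
    case 0
    have "alt M (Suc 0) a = - X a" by (auto simp: X_def)
    with diag_enumerates[of X a h, OF X] show ?case unfolding U_1 by blast
  next
    case (Suc m)
    then show ?case unfolding alt.simps(2)[of _ "Suc m"] by blast
  qed
  then have "diag X h \<in> U n 0 \<longleftrightarrow> diag X h \<in> Q" for h unfolding n using M(2)[of 0] n by metis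
  with that[of "diag X"] psnd_diag diag_local show ?thesis by blast
qed

section \<open>Genericity by Baire category\<close>

text \<open>The Baire category theorem: a word is extended into one \<open>D c\<close> after
  another, and \<open>H\<close> is the limit.\<close>

lemma Baire_words:
  assumes "\<And>c \<sigma>. \<exists>\<tau>. cylinder (\<sigma> @ \<tau>) \<subseteq> D c"
  shows "\<exists>H. \<forall>c::nat. H \<in> D c"
proof -
  have "\<forall>c. \<exists>e. \<forall>\<sigma>. cylinder (\<sigma> @ e \<sigma>) \<subseteq> D c" by (intro allI choice assms)
  then have "\<exists>ext. \<forall>c \<sigma>. cylinder (\<sigma> @ ext c \<sigma>) \<subseteq> D c" by (rule choice)
  then obtain ext where ext: "\<And>c \<sigma>. cylinder (\<sigma> @ ext c \<sigma>) \<subseteq> D c" by blast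
  \<comment> \<open>The extra entry 0 makes the words grow even when the chosen extension is
    empty.\<close>
  define s where "s = rec_nat [] (\<lambda>c \<sigma>. (\<sigma> @ ext c \<sigma>) @ [0])"
  have s: "s (Suc c) = (s c @ ext c (s c)) @ [0]" for c by (simp add: s_def)
  have len: "c \<le> length (s c)" for c by (induction c) (auto simp: s)
  define H where "H i = s (Suc i) ! i" for i
  have pre: "i < length (s c) \<Longrightarrow> s (c + d) ! i = s c ! i \<and> i < length (s (c + d))" for c d i
    by (induction d) (auto simp: s nth_append)
  have H: "H i = s c ! i" if "i < length (s c)" for i c
  proof (cases "Suc i \<le> c")
    case True
    then have "s c ! i = s (Suc i) ! i" using pre[of i "Suc i" "c - Suc i"] len[of "Suc i"] by auto
    then show ?thesis unfolding H_def by simp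
  next
    case False
    then show ?thesis unfolding H_def using pre[OF that, of "Suc i - c"] by simp
  qed
  have "H \<in> D c" for c
  proof -
    have "H \<in> cylinder (s c @ ext c (s c))"
      unfolding cylinder_def
    proof safe
      fix i assume "i < length (s c @ ext c (s c))"
      then show "H i = (s c @ ext c (s c)) ! i"
        using H[of i "Suc c"] unfolding s by (simp add: nth_append del: append_assoc)
    qed
    with ext show ?thesis by blast
  qed
  then show ?thesis by blast
qed

text \<open>All \<open>h k\<close> are columns of one generic \<open>H\<close>. For
  \<open>k \<noteq> l\<close>, either some \<open>H\<close> extending the given word makes
  functional \<open>e\<close> converge at a fresh argument, and column \<open>l\<close> is changed
  there, leaving column \<open>k\<close> intact; or the word already forces divergence.\<close>

lemma generic_columns:
  fixes F :: "nat \<Rightarrow> (nat \<Rightarrow> nat) \<Rightarrow> nat \<Rightarrow> nat"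
  assumes F: "\<And>k h h' N x. \<forall>i<N. h' i = h i \<Longrightarrow> x < N \<Longrightarrow> F k h' x = F k h x"
  shows "\<exists>h. \<forall>k l e. (\<forall>x. Phi e (F k (h k)) (Suc x) (h l x)) \<longrightarrow> k = l"
proof -
  let ?col = "\<lambda>H k x. H (pr k x) :: nat"
  define D where "D k l e = {H. k \<noteq> l \<longrightarrow> \<not> (\<forall>x. Phi e (F k (?col H k)) (Suc x) (?col H l x))}"
    for k l e
  have opn: "opn {H. Phi e (F k (?col H k)) x y}" for e k x y
    unfolding opn_def
  proof
    fix H assume "H \<in> {H. Phi e (F k (?col H k)) x y}"
    then have "F k (?col H k) \<in> {f. Phi e f x y}" by simp
    from opnD[OF opn_Phi this] obtain N
      where N: "\<forall>f'. (\<forall>i<N. f' i = F k (?col H k) i) \<longrightarrow> f' \<in> {f. Phi e f x y}" ..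
    have "\<exists>M. \<forall>m<N. pr k m < M"
      using finite_nat_set_iff_bounded[of "pr k ` {..<N}"] by auto
    then obtain M where M: "\<And>m. m < N \<Longrightarrow> pr k m < M" by blast
    have "Phi e (F k (?col H' k)) x y" if "\<forall>i<M. H' i = H i" for H'
    proof -
      have "\<forall>i<N. F k (?col H' k) i = F k (?col H k) i"
        by (intro allI impI F[where N = N]) (use M that in auto)
      with N have "F k (?col H' k) \<in> {f. Phi e f x y}" by blast
      then show ?thesis by simp
    qed
    then show "\<exists>N. \<forall>f'. (\<forall>i<N. f' i = H i) \<longrightarrow> f' \<in> {H. Phi e (F k (?col H k)) x y}"
      by (intro exI[of _ M]) simp
  qed
  have "\<exists>\<tau>. cylinder (\<sigma> @ \<tau>) \<subseteq> D k l e" for k l e \<sigma>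
  proof (cases "k \<noteq> l \<and> (\<exists>H\<in>cylinder \<sigma>. \<exists>y. Phi e (F k (?col H k)) (Suc (length \<sigma>)) y)")
    case True
    then obtain H y where H: "k \<noteq> l" "H \<in> cylinder \<sigma>" "Phi e (F k (?col H k)) (Suc (length \<sigma>)) y"
      by blast
    \<comment> \<open>The place of argument \<open>length \<sigma>\<close> in column
      \<open>l\<close>; it lies beyond \<open>\<sigma>\<close>, so the value there is still
      free.\<close>
    let ?z = "pr l (length \<sigma>)"
    let ?H = "H(?z := Suc y)"
    have z: "length \<sigma> \<le> ?z" by (rule le_prod_encode_2)
    let ?S = "{H. Phi e (F k (?col H k)) (Suc (length \<sigma>)) y} \<inter> {H. H ?z = Suc y}"
    have "?col ?H k = ?col H k" using H(1) by auto
    then have "?H \<in> ?S" using H(3) by simp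
    have "opn ?S" by (intro opn_Int opn opn_value)
    from opnD[OF this \<open>?H \<in> ?S\<close>] obtain N
      where N: "\<forall>H'. (\<forall>i<N. H' i = ?H i) \<longrightarrow> H' \<in> ?S" ..
    define \<tau> where "\<tau> = map ?H [length \<sigma>..<length \<sigma> + N]"
    have "H' \<in> D k l e" if "H' \<in> cylinder (\<sigma> @ \<tau>)" for H'
    proof -
      have "H' i = ?H i" if "i < N" for i
      proof (cases "i < length \<sigma>")
        case True
        with z H(2) \<open>H' \<in> cylinder (\<sigma> @ \<tau>)\<close> show ?thesis
          by (force simp: cylinder_def nth_append)
      next
        case False
        then have "H' i = (\<sigma> @ \<tau>) ! i"
          using \<open>H' \<in> cylinder (\<sigma> @ \<tau>)\<close> \<open>i < N\<close> by (simp add: cylinder_def \<tau>_def)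
        also have "\<dots> = ?H i" using False \<open>i < N\<close> by (simp add: nth_append \<tau>_def)
        finally show ?thesis .
      qed
      then have "H' \<in> ?S" using N by blast
      then have "Phi e (F k (?col H' k)) (Suc (length \<sigma>)) y" "H' ?z = Suc y" by simp_all
      then have "\<not> Phi e (F k (?col H' k)) (Suc (length \<sigma>)) (?col H' l (length \<sigma>))"
        using Phi_deterministic by (metis n_not_Suc_n)
      then show ?thesis unfolding D_def by blast
    qed
    then show ?thesis by blast
  next
    case False
    then have "cylinder (\<sigma> @ []) \<subseteq> D k l e" unfolding D_def by auto
    then show ?thesis by blast
  qed
  then have "\<exists>H. \<forall>c. H \<in> D (pfst c) (pfst (psnd c)) (psnd (psnd c))" by (intro Baire_words) blast
  then obtain H where H: "\<And>c. H \<in> D (pfst c) (pfst (psnd c)) (psnd (psnd c))" by blast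
  have "H \<in> D k l e" for k l e using H[of "pr k (pr l e)"] by simp
  then show ?thesis unfolding D_def by (intro exI[of _ "?col H"]) blast
qed

text \<open>Each \<open>f k\<close> is the diagonal sequence against \<open>Q k\<close> over the
  generic column \<open>h k\<close>. The level may vary with \<open>k\<close>, which serves the case
  of Muchnik reducibility.\<close>

lemma diagonal_sequence:
  assumes "\<And>k::nat. n k > 0" "\<And>k. bold_Pi (n k) (Q k)"
  obtains f where "\<And>k. f k \<in> U (n k) 0 \<longleftrightarrow> f k \<in> Q k"
    "\<And>k l e. \<forall>x. Phi e (f k) (Suc x) (psnd (f l x)) \<Longrightarrow> k = l"
proof -
  define P where "P k F \<longleftrightarrow> (\<forall>h x. psnd (F h x) = h x) \<and>
    (\<forall>h h' N x. (\<forall>i<N. h' i = h i) \<longrightarrow> x < N \<longrightarrow> F h' x = F h x) \<and>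
    (\<forall>h. F h \<in> U (n k) 0 \<longleftrightarrow> F h \<in> Q k)" for k F
  have "\<exists>F. P k F" for k
    unfolding P_def by (rule diag_U[OF assms(1)[of k] assms(2)[of k]]) blast
  then obtain F where "\<And>k. P k (F k)" by metis
  then have F: "\<And>k h x. psnd (F k h x) = h x"
    "\<And>k h h' N x. \<forall>i<N. h' i = h i \<Longrightarrow> x < N \<Longrightarrow> F k h' x = F k h x"
    "\<And>k h. F k h \<in> U (n k) 0 \<longleftrightarrow> F k h \<in> Q k" unfolding P_def by blast+
  have "\<exists>h. \<forall>k l e. (\<forall>x. Phi e (F k (h k)) (Suc x) (h l x)) \<longrightarrow> k = l"
    by (rule generic_columns) (erule (1) F(2))
  then obtain h where "\<And>k l e. (\<forall>x. Phi e (F k (h k)) (Suc x) (h l x)) \<Longrightarrow> k = l" by blast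
  with F(1,3) show ?thesis by (intro that[of "\<lambda>k. F k (h k)"]) simp_all
qed

subsection \<open>The separation\<close>

text \<open>
  A candidate reduction \<open>(V, e)\<close> at a level below \<open>n\<close> is refuted by an \<open>f\<close> that lies in
  \<open>U n 0\<close> iff it lies in \<open>no_zero V e\<close>.
\<close>

definition no_zero :: "(nat \<Rightarrow> (nat \<Rightarrow> nat) set) \<Rightarrow> (nat \<Rightarrow> nat) \<Rightarrow> (nat \<Rightarrow> nat) set" where
  "no_zero V e = - (\<Union>i. V i \<inter> {f. Phi (e i) f 0 0})"

definition candidates :: "nat \<Rightarrow> (nat \<Rightarrow> nat) set set" where
  "candidates n = {no_zero V e | V e m. m < n \<and> uniformly_Pi m V \<and> computable e}"

lemma bold_Pi_candidates: "Q \<in> candidates n \<Longrightarrow> bold_Pi n Q"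
proof -
  assume "Q \<in> candidates n"
  then obtain V e m where Q: "Q = no_zero V e" and m: "m < n" and V: "uniformly_Pi m V"
    unfolding candidates_def by blast
  from V obtain h where "\<forall>i. Pi_index m (h i) (V i)" unfolding uniformly_Pi_def by blast
  then have "bold_Pi m (V i)" for i by (intro bold_Pi_Pi_index[of m "h i"]) simp
  then show ?thesis unfolding Q no_zero_def by (intro bold_Pi_Compl_UN[OF m] opn_Phi)
qed

section \<open>Countability of the candidate reductions\<close>

lemma countable_computable: "countable {h. computable h}"
proof -
  have "\<exists>e. \<forall>x. phi e x (h x)" if "computable h" for h using that unfolding computable_def .
  then obtain e where e: "\<And>h x. computable h \<Longrightarrow> phi (e h) x (h x)" by metis
  have "inj_on e {h. computable h}"
  proof (rule inj_onI, rule ext)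
    fix h h' x assume "h \<in> {h. computable h}" "h' \<in> {h. computable h}" "e h = e h'"
    then show "h x = h' x" using e[of h x] e[of h' x] Phi_deterministic unfolding phi_def by simp
  qed
  then show ?thesis by (rule countableI)
qed

lemma Pi_index_unique: "Pi_index n e V \<Longrightarrow> Pi_index n e V' \<Longrightarrow> V = V'"
proof (induction n arbitrary: e V V')
  case 0 then show ?case using inj_bcomb_code by auto
next
  case (Suc n)
  from Suc.prems obtain W W' where
    W: "\<And>j. \<exists>k. phi e j k \<and> Pi_index n k (W j)" "V = (\<Inter>j. - W j)"
    "\<And>j. \<exists>k. phi e j k \<and> Pi_index n k (W' j)" "V' = (\<Inter>j. - W' j)" by auto
  have "W j = W' j" for j
    using W(1)[of j] W(3)[of j] Suc.IH Phi_deterministic unfolding phi_def by blast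
  then show ?case using W(2,4) by simp
qed

text \<open>An index determines its class, so a uniform sequence is determined by a computable
  function giving its indices.\<close>

lemma countable_uniformly_Pi: "countable {V. uniformly_Pi n V}"
proof -
  have "{V. uniformly_Pi n V} \<subseteq> (\<lambda>h i. THE X. Pi_index n (h i) X) ` {h. computable h}"
  proof
    fix V assume "V \<in> {V. uniformly_Pi n V}"
    then obtain h where h: "computable h" "\<And>i. Pi_index n (h i) (V i)"
      unfolding uniformly_Pi_def by blast
    have "(THE X. Pi_index n (h i) X) = V i" for i
      using h(2)[of i] Pi_index_unique[OF _ h(2)[of i]] by (rule the_equality)
    then have "V = (\<lambda>i. THE X. Pi_index n (h i) X)" by simp
    with h(1) show "V \<in> (\<lambda>h i. THE X. Pi_index n (h i) X) ` {h. computable h}" by blast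
  qed
  then show ?thesis by (rule countable_subset) (rule countable_image[OF countable_computable])
qed

lemma countable_candidates: "countable (candidates n)"
proof -
  have "candidates n \<subseteq> (\<lambda>(V, e). no_zero V e) `
      ((\<Union>m. {V. uniformly_Pi m V}) \<times> {e. computable e})"
    unfolding candidates_def by force
  moreover have "countable ((\<Union>m. {V. uniformly_Pi m V}) \<times> {e. computable e})"
    using countable_uniformly_Pi countable_computable by (intro countable_SIGMA countable_UN) auto
  ultimately show ?thesis by (rule countable_subset[OF _ countable_image])
qed

lemma candidates_nonempty: "n > 0 \<Longrightarrow> candidates n \<noteq> {}"
proof -
  assume "n > 0"
  then have "no_zero (U 0) (\<lambda>x. x) \<in> candidates n"
    unfolding candidates_def
    using unif_Pi_uniformly_Pi[OF unif_Pi_U[of 0]] tfun_computable[OF tfun_id]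
    by (intro CollectI exI[of _ "U 0"] exI[of _ "\<lambda>x. x"] exI[of _ 0]) simp
  then show ?thesis by blast
qed

section \<open>The separating mass problems\<close>

text \<open>The solution belonging to \<open>f\<close>: place 0 holds an answer bit, and the shifted
  second components identify \<open>f\<close> within the diagonal sequence.\<close>

definition tag :: "nat \<Rightarrow> (nat \<Rightarrow> nat) \<Rightarrow> nat \<Rightarrow> nat" where
  "tag b f x = (if x = 0 then b else psnd (f (x - 1)))"

lemma tag_reduction: "\<exists>e. \<forall>f. Phi_total e f (tag b f)"
proof -
  have "tfun (\<lambda>f x. if x = 0 then b else psnd (f (x - 1)))"
    by (rule tfun_intros tfun_comp[OF tfun_oracle])+
  then obtain p where "\<And>f x. eval f p [x] (tag b f x)" unfolding tfun_def tag_def by blast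
  then show ?thesis unfolding Phi_total_def Phi_def by blast
qed

lemma separating_pair:
  assumes "N \<noteq> {}" "\<And>n. n \<in> N \<Longrightarrow> n > 0"
  shows "\<exists>A B. (\<forall>f\<in>B. \<exists>n\<in>N. tag (if f \<in> U n 0 then 0 else 1) f \<in> A) \<and>
    (\<forall>n\<in>N. \<forall>m<n. \<not> le_fin m A B)"
proof -
  \<comment> \<open>Pairs record the level, since one class may be a candidate at several levels
    while the choice of \<open>U n 0\<close> depends on \<open>n\<close>.\<close>
  let ?T = "SIGMA n:N. candidates n"
  have T: "?T \<noteq> {}" using assms candidates_nonempty by blast
  have cT: "countable ?T" using countable_candidates by (intro countable_SIGMA) auto
  define q where "q = from_nat_into ?T"
  define n Q where "n k = fst (q k)" and "Q k = snd (q k)" for k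
  have "q k \<in> ?T" for k unfolding q_def by (rule from_nat_into[OF T])
  then have nQ: "n k \<in> N" "Q k \<in> candidates (n k)" for k
    unfolding n_def Q_def by (metis mem_Sigma_iff prod.collapse)+
  obtain f where f: "\<And>k. f k \<in> U (n k) 0 \<longleftrightarrow> f k \<in> Q k"
    "\<And>k l e. \<forall>x. Phi e (f k) (Suc x) (psnd (f l x)) \<Longrightarrow> k = l"
    using diagonal_sequence[of n Q] assms(2) nQ bold_Pi_candidates by metis
  define g where "g k = tag (if f k \<in> Q k then 0 else 1) (f k)" for k
  have "\<not> le_fin m (range g) (range f)" if "m < r" "r \<in> N" for m r
  proof
    assume "le_fin m (range g) (range f)"
    then obtain V e where V: "uniformly_Pi m V" "range f \<subseteq> (\<Union>i. V i)" "computable e"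
      "\<And>i f'. f' \<in> range f \<inter> V i \<Longrightarrow> \<exists>g'\<in>range g. Phi_total (e i) f' g'"
      unfolding le_fin_def by blast
    then have "(r, no_zero V e) \<in> ?T" using that unfolding candidates_def by auto
    then obtain k where k: "q k = (r, no_zero V e)"
      using from_nat_into_surj[OF cT] unfolding q_def by metis
    then have Q: "Q k = no_zero V e" unfolding Q_def by simp
    \<comment> \<open>Beyond place 0 the output is the second components of some \<open>f l\<close>;
      genericity gives \<open>l = k\<close>, so the answer bit must be that of
      \<open>f k\<close>.\<close>
    have out: "Phi (e i) (f k) 0 (g k 0)" if "f k \<in> V i" for i
    proof -
      have "\<exists>g'\<in>range g. Phi_total (e i) (f k) g'" by (rule V(4)) (use that in simp)
      then obtain l where l: "Phi_total (e i) (f k) (g l)" by auto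
      have "Phi (e i) (f k) (Suc x) (psnd (f l x))" for x
      proof -
        have "Phi (e i) (f k) (Suc x) (g l (Suc x))" using l unfolding Phi_total_def ..
        then show ?thesis by (simp add: g_def tag_def)
      qed
      then have "k = l" by (intro f(2) allI)
      with l show ?thesis unfolding Phi_total_def by blast
    qed
    obtain i where i: "f k \<in> V i" using V(2) by blast
    \<comment> \<open>In \<open>no_zero V e\<close> the correct bit is 0, which no applicable
      functional outputs; outside it some applicable functional outputs 0 although the correct bit
      is 1.\<close>
    show False
    proof (cases "f k \<in> Q k")
      case True
      then have "g k 0 = 0" by (simp add: g_def tag_def)
      with out[OF i] i have "f k \<notin> no_zero V e" unfolding no_zero_def by auto
      with True Q show False by simp
    next
      case False
      then obtain i' where i': "f k \<in> V i'" "Phi (e i') (f k) 0 0" unfolding Q no_zero_def by auto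
      have "g k 0 = 1" using False by (simp add: g_def tag_def)
      with out[OF i'(1)] i'(2) Phi_deterministic show False by fastforce
    qed
  qed
  moreover have "\<exists>r\<in>N. tag (if f' \<in> U r 0 then 0 else 1) f' \<in> range g" if f': "f' \<in> range f" for f'
  proof -
    obtain k where k: "f' = f k" using f' by auto
    have "tag (if f' \<in> U (n k) 0 then 0 else 1) f' = g k" by (simp add: k g_def f(1))
    with nQ(1) show ?thesis by (intro bexI[of _ "n k"]) auto
  qed
  ultimately show ?thesis by (intro exI[of _ "range g"] exI[of _ "range f"]) simp
qed

text \<open>The complement of \<open>U n 0\<close> is a union of classes one level lower, so both
  answers are covered by classes of level \<open>n\<close>, each with a constant answer bit.\<close>

lemma le_fin_tag:
  assumes "n > 0" "\<And>f. f \<in> B \<Longrightarrow> tag (if f \<in> U n 0 then 0 else 1) f \<in> A"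
  shows "le_fin n A B"
proof -
  obtain k where n: "n = Suc k" using assms(1) by (cases n) auto
  \<comment> \<open>Index 0 stands for \<open>U n 0\<close>, and index \<open>Suc j\<close> for the
    \<open>j\<close>-th piece of its complement.\<close>
  let ?V = "\<lambda>i. if i = 0 then U n 0 else U k (pr 0 (i - 1))"
  have "unif_Pi n (\<lambda>i. U n 0)" by (rule unif_Pi_subst[OF unif_Pi_U tfun_const])
  moreover have "tfun (\<lambda>f i. pr 0 (i - 1))" by (rule tfun_intros)+
  then have "unif_Pi n (\<lambda>i. U k (pr 0 (i - 1)))"
    unfolding n by (rule unif_Pi_subst[OF unif_Pi_Suc[OF unif_Pi_U]])
  ultimately have V: "uniformly_Pi n ?V"
    by (intro unif_Pi_uniformly_Pi unif_Pi_if tfun_id)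
  obtain e0 e1 where e: "\<And>f. Phi_total e0 f (tag 0 f)" "\<And>f. Phi_total e1 f (tag 1 f)"
    using tag_reduction by metis
  have c: "computable (\<lambda>i. if i = 0 then e0 else e1)"
    by (intro tfun_computable tfun_if tfun_id tfun_const)
  have U: "U n 0 = (\<Inter>j. - U k (pr 0 j))" unfolding n by simp
  have "f \<in> (\<Union>i. ?V i)" for f
  proof (cases "f \<in> U n 0")
    case True then show ?thesis by (auto intro!: exI[of _ 0])
  next
    case False
    then obtain j where "f \<in> U k (pr 0 j)" unfolding U by blast
    then have "f \<in> ?V (Suc j)" by simp
    then show ?thesis by blast
  qed
  moreover have "\<exists>g\<in>A. Phi_total (if i = 0 then e0 else e1) f g" if "f \<in> B \<inter> ?V i" for i f
  proof (cases "i = 0")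
    case True
    with that assms(2)[of f] e(1) show ?thesis by auto
  next
    case False
    with that have "f \<notin> U n 0" unfolding U by auto
    with False that assms(2)[of f] e(2) show ?thesis by auto
  qed
  ultimately show ?thesis unfolding le_fin_def using V c by blast
qed

theorem corollary5p4:
  fixes n :: enat
  shows "\<exists>A B :: (nat \<Rightarrow> nat) set. mass_le n A B \<and> (\<forall>m<n. \<not> mass_le m A B)"
proof (cases n)
  case (enat k)
  show ?thesis
  proof (cases "k = 0")
    case True
    \<comment> \<open>No level lies below 0, so any reducible pair will do.\<close>
    have "le_fin 0 {} {}" unfolding le_fin_def
      using unif_Pi_uniformly_Pi[OF unif_Pi_U[of 0]] tfun_computable[OF tfun_id] by blast
    then have "mass_le n {} {}" using enat True by (simp add: mass_le_def)
    moreover have "\<not> m < n" for m using enat True by (simp add: enat_0)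
    ultimately show ?thesis by blast
  next
    case False
    have "\<exists>A B. (\<forall>f\<in>B. \<exists>n\<in>{k}. tag (if f \<in> U n 0 then 0 else 1) f \<in> A) \<and>
        (\<forall>n\<in>{k}. \<forall>m<n. \<not> le_fin m A B)"
      by (rule separating_pair) (use False in auto)
    then obtain A B where AB: "\<forall>f\<in>B. tag (if f \<in> U k 0 then 0 else 1) f \<in> A"
      "\<forall>m<k. \<not> le_fin m A B" by auto
    have "le_fin k A B" by (rule le_fin_tag) (use AB(1) False in simp_all)
    then have "mass_le n A B" using enat by (simp add: mass_le_def)
    moreover have "\<not> mass_le m A B" if m: "m < n" for m
    proof -
      obtain l where "m = enat l" "l < k" using m enat by (cases m) auto
      with AB(2) show ?thesis by (simp add: mass_le_def)
    qed
    ultimately show ?thesis by blast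
  qed
next
  case infinity
  have "\<exists>A B. (\<forall>f\<in>B. \<exists>n\<in>{0<..}. tag (if f \<in> U n 0 then 0 else 1) f \<in> A) \<and>
      (\<forall>n\<in>{0<..}. \<forall>m<n. \<not> le_fin m A B)"
    by (rule separating_pair) auto
  then obtain A B where
    AB: "\<forall>f\<in>B. \<exists>n\<in>{0<..}. tag (if f \<in> U n 0 then 0 else 1) f \<in> A"
    "\<forall>n\<in>{0<..}. \<forall>m<n. \<not> le_fin m A B" by blast
  have "Muchnik_le A B" unfolding Muchnik_le_def
  proof
    fix f assume "f \<in> B"
    with AB(1) obtain b where "tag b f \<in> A" by blast
    then show "\<exists>g\<in>A. \<exists>e. Phi_total e f g" using tag_reduction[of b] by blast
  qed
  then have "mass_le n A B" using infinity by (simp add: mass_le_def)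
  moreover have "\<not> mass_le m A B" if m: "m < n" for m
  proof -
    obtain l where "m = enat l" using m infinity by (cases m) auto
    \<comment> \<open>Level \<open>l\<close> is refuted by the candidates for
      \<open>n = Suc l\<close>.\<close>
    moreover have "\<not> le_fin l A B" using AB(2) by (meson greaterThan_iff lessI zero_less_Suc)
    ultimately show ?thesis by (simp add: mass_le_def)
  qed
  ultimately show ?thesis by blast
qed

end
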